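(* For every $n\ge 2$ and every $a\in\Bbbk$, the $n$-dimensional $\mathcal{B}$-module $\mathcal{U}_a$ is indecomposable.
   Context: $\Bbbk$ is an algebraically closed field of characteristic $0$. The super Jordan plane $\mathcal{B}$ is the associative unital $\Bbbk$-algebra generated by $x_1,x_2$ with defining relations $x_1^2=0$ and $x_2x_{21}=x_{21}x_2+x_1x_{21}$, where $x_{21}:=x_1x_2+x_2x_1$. For $n\ge2$ and $a\in\Bbbk$, $\mathcal{U}_a$ is the $\mathcal{B}$-module with basis $v_1,\ldots,v_n$ and action: $x_1v_2=v_1$ and $x_1v_i=0$ for $i\neq2$; $x_2v_1=av_1$, $x_2v_i=av_i+v_{i+1}$ for $2\le i\le n-1$, and $x_2v_n=av_n$. *)

theory Defs
  imports
    "HOL-Algebra.Algebraic_Closure_Type"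
    "HOL-Computational_Algebra.Polynomial"
    "HOL-Library.Poly_Mapping"
begin

section \<open>Left modules over a not necessarily commutative ring\<close>

text \<open>
  The axioms are those of the locale \<open>module\<close> of HOL-Algebra, which however assumes the ring of
  scalars to be commutative. The library's \<open>submodule\<close> makes no such assumption.
\<close>

locale left_module = R?: ring R + M?: abelian_group M
  for R :: "('a, 'c) ring_scheme" (structure) and M :: "('a, 'b, 'd) module_scheme" (structure) +
  assumes smult_closed:
      "\<lbrakk>a \<in> carrier R; x \<in> carrier M\<rbrakk> \<Longrightarrow> a \<odot>\<^bsub>M\<^esub> x \<in> carrier M"
    and smult_l_distr:
      "\<lbrakk>a \<in> carrier R; b \<in> carrier R; x \<in> carrier M\<rbrakk> \<Longrightarrow>
        (a \<oplus>\<^bsub>R\<^esub> b) \<odot>\<^bsub>M\<^esub> x = a \<odot>\<^bsub>M\<^esub> x \<oplus>\<^bsub>M\<^esub> b \<odot>\<^bsub>M\<^esub> x"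
    and smult_r_distr:
      "\<lbrakk>a \<in> carrier R; x \<in> carrier M; y \<in> carrier M\<rbrakk> \<Longrightarrow>
        a \<odot>\<^bsub>M\<^esub> (x \<oplus>\<^bsub>M\<^esub> y) = a \<odot>\<^bsub>M\<^esub> x \<oplus>\<^bsub>M\<^esub> a \<odot>\<^bsub>M\<^esub> y"
    and smult_assoc1:
      "\<lbrakk>a \<in> carrier R; b \<in> carrier R; x \<in> carrier M\<rbrakk> \<Longrightarrow>
        (a \<otimes>\<^bsub>R\<^esub> b) \<odot>\<^bsub>M\<^esub> x = a \<odot>\<^bsub>M\<^esub> (b \<odot>\<^bsub>M\<^esub> x)"
    and smult_one:
      "x \<in> carrier M \<Longrightarrow> \<one>\<^bsub>R\<^esub> \<odot>\<^bsub>M\<^esub> x = x"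

definition indecomposable_module ::
    "('a, 'c) ring_scheme \<Rightarrow> ('a, 'b, 'd) module_scheme \<Rightarrow> bool" where
  "indecomposable_module R M \<longleftrightarrow>
     left_module R M \<and> carrier M \<noteq> {\<zero>\<^bsub>M\<^esub>} \<and>
     (\<forall>N L. submodule N R M \<and> submodule L R M \<and>
            N <+>\<^bsub>M\<^esub> L = carrier M \<and> N \<inter> L = {\<zero>\<^bsub>M\<^esub>} \<longrightarrow>
            N = {\<zero>\<^bsub>M\<^esub>} \<or> L = {\<zero>\<^bsub>M\<^esub>})"


section \<open>The free algebra on two generators\<close>

datatype 'g free_monoid = Word (letters: "'g list")

instantiation free_monoid :: (type) monoid_add
begin

definition zero_free_monoid :: "'a free_monoid" where
  "zero_free_monoid = Word []"

definition plus_free_monoid :: "'a free_monoid \<Rightarrow> 'a free_monoid \<Rightarrow> 'a free_monoid" where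
  "plus_free_monoid u v = Word (letters u @ letters v)"

instance
  by standard (simp_all add: zero_free_monoid_def plus_free_monoid_def)

end

datatype gen = Gen1 | Gen2

text \<open>
  The free monoid is written additively because the convolution product of \<open>Poly_Mapping\<close> uses
  \<open>+\<close> on exponents; so \<open>'k free_alg\<close> is the algebra of noncommutative polynomials.
\<close>

type_synonym 'k free_alg = "gen free_monoid \<Rightarrow>\<^sub>0 'k"

definition gen_var :: "gen \<Rightarrow> 'k::field free_alg" where
  "gen_var g = Poly_Mapping.single (Word [g]) 1"

definition const_alg :: "'k::field \<Rightarrow> 'k free_alg" where
  "const_alg c = Poly_Mapping.single 0 c"

abbreviation free_ring :: "'k::field free_alg ring" where
  "free_ring \<equiv> ring_of_type_algebra"


section \<open>The super Jordan plane\<close>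

definition sjp_relations :: "'k::field free_alg set" where
  "sjp_relations =
     (let x1 = gen_var Gen1; x2 = gen_var Gen2; x21 = x1 * x2 + x2 * x1
      in {x1 ^ 2, x2 * x21 - (x21 * x2 + x1 * x21)})"

definition sjp_ideal :: "'k::field free_alg set" where
  "sjp_ideal = Idl\<^bsub>free_ring\<^esub> sjp_relations"

definition super_jordan_plane :: "'k::field free_alg set ring" where
  "super_jordan_plane = free_ring Quot sjp_ideal"

definition sjp_class :: "'k::field free_alg \<Rightarrow> 'k free_alg set" where
  "sjp_class p = sjp_ideal +>\<^bsub>free_ring\<^esub> p"


section \<open>The modules $U_a$\<close>

text \<open>
  Vectors are coordinate functions supported on \<open>{1..n}\<close>, and \<open>unit_fun i\<close> is the basis
  vector $v_i$.
\<close>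

definition unit_fun :: "nat \<Rightarrow> nat \<Rightarrow> 'k::field" where
  "unit_fun i = (\<lambda>j. if j = i then 1 else 0)"

fun U_basis_action :: "nat \<Rightarrow> 'k::field \<Rightarrow> gen \<Rightarrow> nat \<Rightarrow> (nat \<Rightarrow> 'k)" where
  "U_basis_action n a Gen1 i = (if i = 2 then unit_fun 1 else (\<lambda>j. 0))"
| "U_basis_action n a Gen2 i =
     (if 2 \<le> i \<and> i \<le> n - 1 then (\<lambda>j. a * unit_fun i j + unit_fun (i + 1) j)
      else (\<lambda>j. a * unit_fun i j))"

definition U_gen_action ::
    "nat \<Rightarrow> 'k::field \<Rightarrow> gen \<Rightarrow> (nat \<Rightarrow> 'k) \<Rightarrow> (nat \<Rightarrow> 'k)" where
  "U_gen_action n a g v = (\<lambda>j. \<Sum>i\<in>{1..n}. v i * U_basis_action n a g i j)"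

definition free_action ::
    "(gen \<Rightarrow> (nat \<Rightarrow> 'k) \<Rightarrow> (nat \<Rightarrow> 'k)) \<Rightarrow> 'k::field free_alg \<Rightarrow> (nat \<Rightarrow> 'k) \<Rightarrow> (nat \<Rightarrow> 'k)" where
  "free_action T p v =
     (\<lambda>j. \<Sum>w\<in>Poly_Mapping.keys p. Poly_Mapping.lookup p w * foldr T (letters w) v j)"

text \<open>
  A residue class acts through any of its representatives; lemma \<open>U_smult_class\<close> below shows
  that the choice is irrelevant. The record type of modules extends that of rings, so it has
  fields \<open>mult\<close> and \<open>one\<close>, which play no role.
\<close>

definition U_module ::
    "nat \<Rightarrow> 'k::field \<Rightarrow> ('k free_alg set, nat \<Rightarrow> 'k) module" where
  "U_module n a =
     \<lparr>carrier = {v. \<forall>i. i \<notin> {1..n} \<longrightarrow> v i = 0},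
      monoid.mult = undefined, monoid.one = undefined,
      ring.zero = (\<lambda>j. 0), ring.add = (\<lambda>u v j. u j + v j),
      module.smult = (\<lambda>C v. free_action (U_gen_action n a) (SOME p. p \<in> C) v)\<rparr>"


section \<open>Well-definedness\<close>

lemma ring_free_ring: "ring (free_ring :: 'k::field free_alg ring)"
proof -
  have "\<exists>y. x + y = 0" "\<exists>y. y + x = 0" for x :: "'k free_alg"
    by (rule exI[of _ "- x"], simp)+
  thus ?thesis
    unfolding ring_of_type_algebra_def
    by unfold_locales (auto simp: algebra_simps Units_def)
qed

lemma free_ring_simps [simp]:
  "carrier free_ring = UNIV" "\<zero>\<^bsub>free_ring\<^esub> = 0" "\<one>\<^bsub>free_ring\<^esub> = 1"
  "p \<oplus>\<^bsub>free_ring\<^esub> q = p + q" "p \<otimes>\<^bsub>free_ring\<^esub> q = p * q"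
  by (simp_all add: ring_of_type_algebra_def)

lemma ideal_sjp_ideal: "ideal (sjp_ideal :: 'k::field free_alg set) free_ring"
  unfolding sjp_ideal_def by (rule ring.genideal_ideal[OF ring_free_ring]) simp

lemma ring_super_jordan_plane: "ring (super_jordan_plane :: 'k::field free_alg set ring)"
  unfolding super_jordan_plane_def by (rule ideal.quotient_is_ring[OF ideal_sjp_ideal])

lemma sjp_class_ring_hom: "sjp_class \<in> ring_hom free_ring super_jordan_plane"
  using ideal.rcos_ring_hom[OF ideal_sjp_ideal]
  unfolding super_jordan_plane_def sjp_class_def[abs_def] .

lemma carrier_super_jordan_plane: "carrier super_jordan_plane = range sjp_class"
  by (auto simp: super_jordan_plane_def FactRing_def A_RCOSETS_def' sjp_class_def)

lemma mem_sjp_class_iff: "q \<in> sjp_class p \<longleftrightarrow> q - p \<in> sjp_ideal"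
proof
  assume "q - p \<in> sjp_ideal"
  moreover have "q = (q - p) + p" by simp
  ultimately show "q \<in> sjp_class p"
    unfolding sjp_class_def a_r_coset_def' by force
qed (auto simp: sjp_class_def a_r_coset_def')

lemma free_action_superset:
  assumes "finite S" "Poly_Mapping.keys p \<subseteq> S"
  shows "free_action T p v j = (\<Sum>w\<in>S. Poly_Mapping.lookup p w * foldr T (letters w) v j)"
  unfolding free_action_def
  by (rule sum.mono_neutral_left) (use assms in \<open>auto simp: in_keys_iff\<close>)

lemma free_action_0: "free_action T 0 v = (\<lambda>j. 0)"
  by (simp add: free_action_def)

lemma free_action_single:
  "free_action T (Poly_Mapping.single w c) v = (\<lambda>j. c * foldr T (letters w) v j)"
  by (auto simp: free_action_def)

lemma free_action_add:
  "free_action T (p + q) v = (\<lambda>j. free_action T p v j + free_action T q v j)"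
proof
  fix j
  let ?S = "Poly_Mapping.keys p \<union> Poly_Mapping.keys q"
  have "Poly_Mapping.keys (p + q) \<subseteq> ?S"
    by (rule Poly_Mapping.keys_add)
  thus "free_action T (p + q) v j = free_action T p v j + free_action T q v j"
    by (simp add: free_action_superset[of ?S] lookup_add distrib_right sum.distrib)
qed

lemma free_action_uminus: "free_action T (- p) v = (\<lambda>j. - free_action T p v j)"
proof
  fix j
  have "free_action T (p + - p) v j = free_action T p v j + free_action T (- p) v j"
    by (simp only: free_action_add)
  thus "free_action T (- p) v j = - free_action T p v j"
    by (simp add: free_action_0 minus_unique)
qed

lemma free_action_diff:
  "free_action T (p - q) v = (\<lambda>j. free_action T p v j - free_action T q v j)"
  using free_action_add[of T p "- q" v] by (simp add: free_action_uminus)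

lemma free_alg_induct [case_names single add]:
  assumes "\<And>w c. P (Poly_Mapping.single w c)" "\<And>p q. P p \<Longrightarrow> P q \<Longrightarrow> P (p + q)"
  shows "P (p :: 'k::field free_alg)"
proof -
  have "P (\<Sum>w\<in>S. Poly_Mapping.single w (Poly_Mapping.lookup p w))" if "finite S" for S
    using that
  proof (induction S)
    case empty
    show ?case using assms(1)[of 0 0] by simp
  qed (simp add: assms)
  moreover have "p = (\<Sum>w\<in>Poly_Mapping.keys p. Poly_Mapping.single w (Poly_Mapping.lookup p w))"
    by (rule poly_mapping_eqI)
      (simp add: lookup_sum lookup_single when_def sum.delta in_keys_iff)
  ultimately show ?thesis by (metis finite_keys)
qed

lemma U_gen_action_add:
  "U_gen_action n a g (\<lambda>j. u j + v j) = (\<lambda>j. U_gen_action n a g u j + U_gen_action n a g v j)"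
  by (simp add: U_gen_action_def distrib_right sum.distrib)

lemma U_gen_action_scale:
  "U_gen_action n a g (\<lambda>j. c * v j) = (\<lambda>j. c * U_gen_action n a g v j)"
  by (simp add: U_gen_action_def sum_distrib_left mult.assoc)

lemma U_word_add:
  "foldr (U_gen_action n a) ws (\<lambda>j. u j + v j) =
   (\<lambda>j. foldr (U_gen_action n a) ws u j + foldr (U_gen_action n a) ws v j)"
  by (induction ws) (simp_all add: U_gen_action_add)

lemma U_word_scale:
  "foldr (U_gen_action n a) ws (\<lambda>j. c * v j) = (\<lambda>j. c * foldr (U_gen_action n a) ws v j)"
  by (induction ws) (simp_all add: U_gen_action_scale)

lemma U_free_action_vec_add:
  "free_action (U_gen_action n a) p (\<lambda>j. u j + v j) =
   (\<lambda>j. free_action (U_gen_action n a) p u j + free_action (U_gen_action n a) p v j)"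
  by (simp add: free_action_def U_word_add distrib_left sum.distrib)

lemma U_free_action_vec_scale:
  "free_action (U_gen_action n a) p (\<lambda>j. c * v j) =
   (\<lambda>j. c * free_action (U_gen_action n a) p v j)"
  by (simp add: free_action_def U_word_scale sum_distrib_left mult.left_commute)

lemma U_free_action_vec_0: "free_action (U_gen_action n a) p (\<lambda>j. 0) = (\<lambda>j. 0)"
  using U_free_action_vec_scale[of n a p 0 "\<lambda>j. 0"] by simp

lemma U_free_action_mult:
  "free_action (U_gen_action n a) (p * q) v =
   free_action (U_gen_action n a) p (free_action (U_gen_action n a) q v)"
proof (induction p rule: free_alg_induct)
  case (single w c)
  show ?case
  proof (induction q rule: free_alg_induct)
    case (single w' c')
    show ?case
      by (simp add: mult_single free_action_single plus_free_monoid_def U_word_scale mult.assoc)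
  next
    case (add q r)
    thus ?case by (simp add: distrib_left free_action_add U_free_action_vec_add)
  qed
next
  case (add p r)
  thus ?case by (simp add: distrib_right free_action_add)
qed

lemma free_action_gen_var: "free_action T (gen_var g) v = T g v"
  by (simp add: gen_var_def free_action_single)

lemma free_action_const: "free_action T (const_alg c) v = (\<lambda>j. c * v j)"
  by (simp add: const_alg_def free_action_single zero_free_monoid_def)

lemma U_gen_action_unit_fun:
  assumes "i \<in> {1..n}"
  shows "U_gen_action n a g (unit_fun i) = U_basis_action n a g i"
proof
  fix j
  have "U_gen_action n a g (unit_fun i) j =
      (\<Sum>k\<in>{1..n}. if k = i then U_basis_action n a g i j else 0)"
    unfolding U_gen_action_def by (rule sum.cong) (auto simp: unit_fun_def)
  also have "\<dots> = U_basis_action n a g i j"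
    using assms by simp
  finally show "U_gen_action n a g (unit_fun i) j = U_basis_action n a g i j" .
qed

lemma U_gen_action_1:
  assumes "n \<ge> 2"
  shows "U_gen_action n a Gen1 v = (\<lambda>j. if j = 1 then v 2 else 0)"
proof
  fix j
  have "U_gen_action n a Gen1 v j = (\<Sum>i\<in>{1..n}. if i = 2 then v 2 * unit_fun 1 j else 0)"
    unfolding U_gen_action_def by (rule sum.cong) auto
  also have "\<dots> = v 2 * unit_fun 1 j"
    using assms by simp
  finally show "U_gen_action n a Gen1 v j = (if j = 1 then v 2 else 0)"
    by (simp add: unit_fun_def)
qed

lemma U_gen_action_2:
  "U_gen_action n a Gen2 v =
     (\<lambda>j. if j \<in> {1..n} then a * v j + (if j \<ge> 3 then v (j - 1) else 0) else 0)"
proof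
  fix j
  have "U_gen_action n a Gen2 v j =
     (\<Sum>i\<in>{1..n}. (if i = j then a * v j else 0) +
        (if i = j - 1 then (if 3 \<le> j \<and> j \<le> n then v (j - 1) else 0) else 0))"
    unfolding U_gen_action_def by (rule sum.cong) (auto simp: unit_fun_def algebra_simps)
  also have "\<dots> = (if j \<in> {1..n} then a * v j else 0) +
      (if j - 1 \<in> {1..n} then (if 3 \<le> j \<and> j \<le> n then v (j - 1) else 0) else 0)"
    by (simp only: sum.distrib sum.delta finite_atLeastAtMost)
  also have "\<dots> = (if j \<in> {1..n} then a * v j + (if j \<ge> 3 then v (j - 1) else 0) else 0)"
    by auto
  finally show "U_gen_action n a Gen2 v j = \<dots>" .
qed

lemma sjp_relations_act_0:
  fixes p :: "'k::field free_alg"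
  assumes "n \<ge> 2" "p \<in> sjp_relations"
  shows "free_action (U_gen_action n a) p v = (\<lambda>j. 0)"
proof -
  note action_simps = free_action_add free_action_diff U_free_action_mult free_action_gen_var
    U_gen_action_1[OF assms(1)] U_gen_action_2
  let ?x1 = "gen_var Gen1 :: 'k free_alg" and ?x2 = "gen_var Gen2 :: 'k free_alg"
  consider "p = ?x1 ^ 2"
    | "p = ?x2 * (?x1 * ?x2 + ?x2 * ?x1) -
        ((?x1 * ?x2 + ?x2 * ?x1) * ?x2 + ?x1 * (?x1 * ?x2 + ?x2 * ?x1))"
    using assms(2) by (auto simp: sjp_relations_def Let_def)
  thus ?thesis
  proof cases
    case 1
    show ?thesis
      unfolding 1 power2_eq_square action_simps by (simp add: fun_eq_iff)
  next
    case 2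
    show ?thesis
      unfolding 2 action_simps using assms(1) by (simp add: fun_eq_iff) presburger
  qed
qed

lemma sjp_ideal_act_0:
  fixes p :: "'k::field free_alg"
  assumes "n \<ge> 2" "p \<in> sjp_ideal"
  shows "free_action (U_gen_action n a) p v = (\<lambda>j. 0)"
proof -
  let ?K = "{p :: 'k free_alg. \<forall>v. free_action (U_gen_action n a) p v = (\<lambda>j. 0)}"
  interpret F: ring "free_ring :: 'k free_alg ring" by (rule ring_free_ring)
  have inv: "inv\<^bsub>add_monoid free_ring\<^esub> q = - q" for q :: "'k free_alg"
    using F.minus_equality[of "- q" q] by (simp add: a_inv_def)
  have "ideal ?K free_ring"
  proof (rule idealI)
    show "subgroup ?K (add_monoid free_ring)"
    proof (rule group.subgroupI[OF F.a_group])
      show "?K \<noteq> {}"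
        using free_action_0 by blast
      show "inv\<^bsub>add_monoid free_ring\<^esub> q \<in> ?K" if "q \<in> ?K" for q
        using that unfolding inv by (simp add: free_action_uminus)
    qed (simp_all add: free_action_add)
  qed (auto simp: ring_free_ring U_free_action_mult U_free_action_vec_0)
  moreover have "sjp_relations \<subseteq> ?K"
    using sjp_relations_act_0[OF assms(1)] by blast
  ultimately have "sjp_ideal \<subseteq> ?K"
    unfolding sjp_ideal_def by (rule F.genideal_minimal)
  thus ?thesis using assms(2) by blast
qed

lemma U_smult_class:
  assumes "n \<ge> 2"
  shows "sjp_class p \<odot>\<^bsub>U_module n a\<^esub> v = free_action (U_gen_action n a) p v"
proof -
  have "p \<in> sjp_class p"
    using additive_subgroup.zero_closed[OF ideal.axioms(1)[OF ideal_sjp_ideal]]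
    by (simp add: mem_sjp_class_iff)
  hence "(SOME q. q \<in> sjp_class p) \<in> sjp_class p"
    by (rule someI)
  hence "(SOME q. q \<in> sjp_class p) - p \<in> sjp_ideal"
    by (simp add: mem_sjp_class_iff)
  from sjp_ideal_act_0[OF assms this, of a v] show ?thesis
    by (simp add: U_module_def free_action_diff fun_eq_iff)
qed

lemma U_carrier_gen_action:
  assumes "n \<ge> 2" "v \<in> carrier (U_module n a)"
  shows "U_gen_action n a g v \<in> carrier (U_module n a)"
  using assms by (cases g) (auto simp: U_module_def U_gen_action_1 U_gen_action_2)

lemma U_carrier_free_action:
  assumes "n \<ge> 2" "v \<in> carrier (U_module n a)"
  shows "free_action (U_gen_action n a) p v \<in> carrier (U_module n a)"
proof -
  have "foldr (U_gen_action n a) ws v \<in> carrier (U_module n a)" for ws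
    by (induction ws) (use assms U_carrier_gen_action in auto)
  thus ?thesis
    by (auto simp: free_action_def U_module_def intro!: sum.neutral)
qed

lemma left_module_U:
  fixes a :: "'k::field"
  assumes "n \<ge> 2"
  shows "left_module super_jordan_plane (U_module n a)"
proof -
  have hom: "(sjp_class :: 'k free_alg \<Rightarrow> _) \<in> ring_hom free_ring super_jordan_plane"
    by (rule sjp_class_ring_hom)
  have "abelian_group (U_module n a)"
  proof (rule abelian_groupI)
    fix x assume "x \<in> carrier (U_module n a)"
    thus "\<exists>y\<in>carrier (U_module n a). y \<oplus>\<^bsub>U_module n a\<^esub> x = \<zero>\<^bsub>U_module n a\<^esub>"
      by (intro bexI[of _ "\<lambda>j. - x j"]) (auto simp: U_module_def)
  qed (auto simp: U_module_def algebra_simps)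
  moreover have "left_module_axioms super_jordan_plane (U_module n a)"
  proof
    fix C D :: "'k free_alg set" and x y :: "nat \<Rightarrow> 'k"
    assume "C \<in> carrier super_jordan_plane"
    then obtain p where C: "C = sjp_class p"
      by (auto simp: carrier_super_jordan_plane)
    show "C \<odot>\<^bsub>U_module n a\<^esub> x \<in> carrier (U_module n a)" if "x \<in> carrier (U_module n a)"
      using that U_carrier_free_action[OF assms] by (simp add: C U_smult_class[OF assms])
    show "C \<odot>\<^bsub>U_module n a\<^esub> (x \<oplus>\<^bsub>U_module n a\<^esub> y) =
        C \<odot>\<^bsub>U_module n a\<^esub> x \<oplus>\<^bsub>U_module n a\<^esub> C \<odot>\<^bsub>U_module n a\<^esub> y"
      unfolding C U_smult_class[OF assms]
      by (simp add: U_module_def U_free_action_vec_add)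
    assume "D \<in> carrier super_jordan_plane"
    then obtain q where D: "D = sjp_class q"
      by (auto simp: carrier_super_jordan_plane)
    have "C \<oplus>\<^bsub>super_jordan_plane\<^esub> D = sjp_class (p + q)"
      using ring_hom_add[OF hom, of p q] by (simp add: C D)
    thus "(C \<oplus>\<^bsub>super_jordan_plane\<^esub> D) \<odot>\<^bsub>U_module n a\<^esub> x =
        C \<odot>\<^bsub>U_module n a\<^esub> x \<oplus>\<^bsub>U_module n a\<^esub> D \<odot>\<^bsub>U_module n a\<^esub> x"
      unfolding C D by (simp add: U_smult_class[OF assms] free_action_add)
        (simp add: U_module_def)
    have "C \<otimes>\<^bsub>super_jordan_plane\<^esub> D = sjp_class (p * q)"
      using ring_hom_mult[OF hom, of p q] by (simp add: C D)
    thus "(C \<otimes>\<^bsub>super_jordan_plane\<^esub> D) \<odot>\<^bsub>U_module n a\<^esub> x =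
        C \<odot>\<^bsub>U_module n a\<^esub> (D \<odot>\<^bsub>U_module n a\<^esub> x)"
      unfolding C D by (simp add: U_smult_class[OF assms] U_free_action_mult)
  next
    fix x :: "nat \<Rightarrow> 'k"
    have "\<one>\<^bsub>super_jordan_plane\<^esub> = sjp_class (const_alg (1 :: 'k))"
      using ring_hom_one[OF hom] by (simp add: const_alg_def)
    thus "\<one>\<^bsub>super_jordan_plane\<^esub> \<odot>\<^bsub>U_module n a\<^esub> x = x"
      by (simp add: U_smult_class[OF assms] free_action_const)
  qed
  ultimately show ?thesis
    by (intro left_module.intro ring_super_jordan_plane)
qed

text \<open>The vector space structure induced by the scalars of the algebra is the usual one.\<close>

lemma U_smult_const:
  assumes "n \<ge> 2"
  shows "sjp_class (const_alg c) \<odot>\<^bsub>U_module n a\<^esub> v = (\<lambda>j. c * v j)"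
  by (simp add: U_smult_class[OF assms] free_action_const)

lemma U_carrier_coordinates:
  assumes "v \<in> carrier (U_module n a)"
  shows "v = (\<lambda>j. \<Sum>i\<in>{1..n}. v i * unit_fun i j)"
  using assms by (auto simp: U_module_def unit_fun_def fun_eq_iff if_distrib cong: if_cong)

lemma U_smult_gen:
  assumes "n \<ge> 2" "i \<in> {1..n}"
  shows "sjp_class (gen_var g) \<odot>\<^bsub>U_module n a\<^esub> unit_fun i = U_basis_action n a g i"
  using assms by (simp add: U_smult_class free_action_gen_var U_gen_action_unit_fun)

end

(*
  If U_a = N + L is a direct decomposition, one of the summands, say N, contains a vector x whose
  v_2-coordinate is nonzero. Then N contains x_1 x, a nonzero multiple of v_1, and for k = 2, ..., n
  the vector (x_2 - a)^(k - 2) x, whose coordinates at v_2, ..., v_(k - 1) vanish while the one at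
  v_k does not. These vectors span U_a, so N is everything.
*)

theory Submission
  imports Defs
begin

lemma U_module_simps [simp]:
  "v \<in> carrier (U_module n a) \<longleftrightarrow> (\<forall>i. i \<notin> {1..n} \<longrightarrow> v i = 0)"
  "\<zero>\<^bsub>U_module n a\<^esub> = (\<lambda>j. 0)"
  "u \<oplus>\<^bsub>U_module n a\<^esub> v = (\<lambda>j. u j + v j)"
  by (simp_all add: U_module_def)

lemma U_submodule_subset:
  assumes "submodule N super_jordan_plane (U_module n a)"
  shows "N \<subseteq> carrier (U_module n a)"
  using subgroup.subset[OF submodule.axioms(1)[OF assms]] by simp

lemma U_submodule_add:
  assumes "submodule N super_jordan_plane (U_module n a)" "u \<in> N" "v \<in> N"
  shows "(\<lambda>j. u j + v j) \<in> N"
  using subgroup.m_closed[OF submodule.axioms(1)[OF assms(1)] assms(2,3)] by simp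

text \<open>Every residue class acts through any representative, so noncommutative polynomials can
  be applied to \<open>N\<close> directly.\<close>

lemma U_submodule_free_action:
  assumes "n \<ge> 2" "submodule N super_jordan_plane (U_module n a)" "v \<in> N"
  shows "free_action (U_gen_action n a) p v \<in> N"
proof -
  have "sjp_class p \<odot>\<^bsub>U_module n a\<^esub> v \<in> N"
    using assms(2,3) submodule.smult_closed by (fastforce simp: carrier_super_jordan_plane)
  thus ?thesis by (simp add: U_smult_class[OF assms(1)])
qed

text \<open>Closure under scalars comes from the constants of the algebra.\<close>

lemma U_submodule_scale:
  assumes "n \<ge> 2" "submodule N super_jordan_plane (U_module n a)" "v \<in> N"
  shows "(\<lambda>j. c * v j) \<in> N"
  using U_submodule_free_action[OF assms, of "const_alg c"] by (simp add: free_action_const)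

text \<open>Hence all proper submodules lie in the hyperplane of vectors \<open>v\<close> with
  \<open>v 2 = 0\<close>, and two of them cannot sum to the whole module.\<close>

lemma U_submodule_eq_carrier:
  assumes n: "n \<ge> 2" and N: "submodule N super_jordan_plane (U_module n a)"
    and x: "x \<in> N" "x 2 \<noteq> 0"
  shows "N = carrier (U_module n a)"
proof -
  note add = U_submodule_add[OF N]
    and scale = U_submodule_scale[OF n N]
    and act = U_submodule_free_action[OF n N]
  have shifted: "\<exists>w. w \<in> N \<and> w k = x 2 \<and> (\<forall>j\<in>{2..<k}. w j = 0)"
    if "2 \<le> k" "k \<le> n" for k
    using that
  proof (induction k rule: dec_induct)
    case base
    show ?case using x by (intro exI[of _ x]) simp
  next
    case (step k)
    then obtain w where w: "w \<in> N" "w k = x 2" "\<forall>j\<in>{2..<k}. w j = 0"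
      by auto
    let ?w = "free_action (U_gen_action n a) (gen_var Gen2 - const_alg a) w"
    \<comment> \<open>The operator \<open>x_2 - a\<close> kills \<open>v_1\<close> and
      \<open>v_n\<close> and sends \<open>v_i\<close> to \<open>v_(i+1)\<close> in between, so
      nothing arrives at coordinates 1 and 2.\<close>
    have w': "?w j = (if 3 \<le> j then w (j - 1) else 0)" if "1 \<le> j" "j \<le> n" for j
      using that by (simp add: free_action_diff free_action_gen_var free_action_const
        U_gen_action_2)
    have "?w (Suc k) = x 2"
      using step w(2) w'[of "Suc k"] by simp
    moreover have "\<forall>j\<in>{2..<Suc k}. ?w j = 0"
      using step.prems by (auto simp: w' intro!: w(3)[rule_format])
    ultimately show ?case
      by (intro exI[of _ ?w] conjI act[OF w(1)])
  qed
  \<comment> \<open>Triangular elimination, by downward induction on \<open>k\<close>: at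
    \<open>k = n + 1\<close> only coordinate 1 can be nonzero.\<close>
  have "z \<in> N"
    if "k \<le> n + 1" "2 \<le> k" "z \<in> carrier (U_module n a)" "\<forall>j\<in>{2..<k}. z j = 0" for k z
    using that
  proof (induction k arbitrary: z rule: inc_induct)
    case base
    \<comment> \<open>The generator \<open>x_1\<close> sends \<open>x\<close> to \<open>x 2\<close>
      times \<open>v_1\<close>.\<close>
    have "(\<lambda>j. z 1 / x 2 * free_action (U_gen_action n a) (gen_var Gen1) x j) \<in> N"
      by (intro scale act x)
    moreover have "z j = 0" if "j \<noteq> 1" for j
      using base that by (cases "j \<in> {1..n}") auto
    hence "z = (\<lambda>j. z 1 / x 2 * free_action (U_gen_action n a) (gen_var Gen1) x j)"
      using x(2) by (auto simp: free_action_gen_var U_gen_action_1[OF n])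
    ultimately show ?case by simp
  next
    case (step k)
    from shifted[of k] step.hyps step.prems(1) obtain w
      where w: "w \<in> N" "w k = x 2" "\<forall>j\<in>{2..<k}. w j = 0"
      by auto
    \<comment> \<open>Since \<open>w k = x 2\<close>, this clears coordinate \<open>k\<close>; the
      zeros at 2, ..., \<open>k - 1\<close> survive because \<open>w\<close> vanishes there
      too.\<close>
    let ?z = "\<lambda>j. z j + - (z k / x 2) * w j"
    have z: "?z \<in> N"
    proof (rule step.IH)
      show "?z \<in> carrier (U_module n a)"
        using step.prems subsetD[OF U_submodule_subset[OF N] w(1)] by simp
      show "\<forall>j\<in>{2..<Suc k}. ?z j = 0"
        using step.prems w x(2) by (auto simp: less_Suc_eq)
    qed (use step.prems in simp)
    show ?case using add[OF z scale[OF w(1), of "z k / x 2"]] by simp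
  qed
  \<comment> \<open>For \<open>k = 2\<close> the vanishing condition is empty.\<close>
  from this[of 2] n have "carrier (U_module n a) \<subseteq> N" by auto
  with U_submodule_subset[OF N] show ?thesis by blast
qed

theorem theorem4p2:
  fixes n :: nat and a :: "'k::{alg_closed_field, field_char_0}"
  assumes "n \<ge> 2"
  shows "indecomposable_module super_jordan_plane (U_module n a)"
  unfolding indecomposable_module_def
proof (intro conjI allI impI)
  show "left_module super_jordan_plane (U_module n a)"
    by (rule left_module_U[OF assms])
  have v2: "unit_fun 2 \<in> carrier (U_module n a)"
    using assms by (auto simp: unit_fun_def)
  moreover have "unit_fun 2 \<noteq> (\<lambda>j. 0 :: 'k)"
    by (auto simp: unit_fun_def fun_eq_iff)
  ultimately show "carrier (U_module n a) \<noteq> {\<zero>\<^bsub>U_module n a\<^esub>}"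
    by (metis U_module_simps(2) singletonD)
  fix N L
  assume *: "submodule N super_jordan_plane (U_module n a) \<and>
    submodule L super_jordan_plane (U_module n a) \<and>
    N <+>\<^bsub>U_module n a\<^esub> L = carrier (U_module n a) \<and> N \<inter> L = {\<zero>\<^bsub>U_module n a\<^esub>}"
  with v2 have "unit_fun 2 \<in> N <+>\<^bsub>U_module n a\<^esub> L" by blast
  then obtain x y where xy: "x \<in> N" "y \<in> L" "unit_fun 2 = (\<lambda>j. x j + y j)"
    by (auto simp: set_add_def set_mult_def U_module_def)
  \<comment> \<open>The two coordinates sum to 1.\<close>
  from fun_cong[OF xy(3), of 2] have "x 2 \<noteq> 0 \<or> y 2 \<noteq> 0"
    by (auto simp: unit_fun_def)
  hence "N = carrier (U_module n a) \<or> L = carrier (U_module n a)"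
    using U_submodule_eq_carrier[OF assms] * xy by blast
  moreover have "N \<subseteq> carrier (U_module n a)" "L \<subseteq> carrier (U_module n a)"
    using * by (simp_all only: U_submodule_subset)
  \<comment> \<open>If one summand is everything, the other equals
    \<open>N \<inter> L\<close>.\<close>
  ultimately show "N = {\<zero>\<^bsub>U_module n a\<^esub>} \<or> L = {\<zero>\<^bsub>U_module n a\<^esub>}"
    using * by blast
qed

end
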